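(* There is an absolute constant $c>0$ such that the following holds. For every instance of the paging problem (pages $[n]$, cache size $k<n$, request sequence $\sigma\in[n]^T$, initial cache configuration of $k$ pages used by both $\mathtt{Sim}$ and $\mathtt{FitF}$) and every NAT prediction sequence $(p_t)_{t\in[T]}$ with $p_t\in(t,T+n]$, the algorithm $\mathtt{Sim}$ run with these predictions satisfies $$\operatorname{cost}(\mathtt{Sim})-\mathtt{OPT}\le c\,(\eta+k),$$ where $\eta=|\{t\in[T]: p_t\neq A_t(\sigma_t)\}|$.
   Context: Paging: $n$ pages, cache of exactly $k<n$ pages, request sequence $\sigma=(\sigma_t)_{t\in[T]}\in[n]^T$ revealed online. A cache miss at round $t$ occurs if $\sigma_t$ is not in the current cache $C_t$; the algorithm then evicts one page of $C_t$ and brings in $\sigma_t$ (algorithms are lazy: no changes on hits). The cost is the number of cache misses. The sequence is augmented with virtual requests $\sigma_{T+i}=i$ for $i\in[n]$, and the next arrival time (NAT) of page $i$ after time $t$ is $A_t(i)=\min\{t'>t:\sigma_{t'}=i\}$. $\mathtt{FitF}$ evicts on a miss the page $i\in C_t$ maximizing $A_t(i)$; it is optimal and $\mathtt{OPT}$ denotes its cost. A NAT predictor outputs at each round $t$ (after $\sigma_t$ is revealed) a prediction $p_t\in(t,T+n]$ of $A_t(\sigma_t)$. Algorithm $\mathtt{Sim}$: fix an integer $Z>T+n$. Define remedy predictions $\hat p_t(i)$ for $t\in[T]$, $i\in[n]$: $\hat p_1(i)=p_1$ if $i=\sigma_1$ and $\hat p_1(i)=Z+1$ otherwise; for $t\ge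 2$, $\hat p_t(i)=p_t$ if $i=\sigma_t$; $\hat p_t(i)=Z$ if $\hat p_{t-1}(i)\le t$, $i\ne\sigma_t$ and $\hat p_{t-1}(i)\le \hat p_{t-1}(\sigma_t)<Z$; and $\hat p_t(i)=\hat p_{t-1}(i)$ otherwise. On a cache miss at round $t$, $\mathtt{Sim}$ evicts a page $i$ of its cache maximizing $\hat p_t(i)$ (ties broken arbitrarily). *)

theory Defs
  imports Complex_Main
begin

text \<open>
  Pages are the numbers in \<open>{1..n}\<close> and rounds the numbers in \<open>{1..T}\<close>; the values of
  \<open>\<sigma>\<close> and \<open>p\<close> outside \<open>{1..T}\<close> are irrelevant. A cache sequence \<open>C\<close> gives in \<open>C t\<close> the
  cache when the request of round \<open>t\<close> arrives, so \<open>C 1\<close> is the initial cache.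
\<close>

definition paging_instance :: "nat \<Rightarrow> nat \<Rightarrow> nat \<Rightarrow> (nat \<Rightarrow> nat) \<Rightarrow> nat set \<Rightarrow> bool" where
  "paging_instance n k T \<sigma> C\<^sub>0 \<longleftrightarrow>
     k < n \<and> (\<forall>t\<in>{1..T}. \<sigma> t \<in> {1..n}) \<and> C\<^sub>0 \<subseteq> {1..n} \<and> card C\<^sub>0 = k"

definition augmented :: "nat \<Rightarrow> (nat \<Rightarrow> nat) \<Rightarrow> nat \<Rightarrow> nat" where
  "augmented T \<sigma> t = (if t \<le> T then \<sigma> t else t - T)"

definition next_arrival :: "nat \<Rightarrow> (nat \<Rightarrow> nat) \<Rightarrow> nat \<Rightarrow> nat \<Rightarrow> nat" where
  "next_arrival T \<sigma> t i = (LEAST t'. t < t' \<and> augmented T \<sigma> t' = i)"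

text \<open>
  The lazy algorithms that, on a miss in round \<open>t\<close>, evict some cached page of maximal
  priority \<open>f t\<close>. Being a relation, it leaves the choice among ties open.
\<close>

definition eviction_run ::
    "nat \<Rightarrow> (nat \<Rightarrow> nat) \<Rightarrow> nat set \<Rightarrow> (nat \<Rightarrow> nat \<Rightarrow> nat) \<Rightarrow> (nat \<Rightarrow> nat set) \<Rightarrow> bool" where
  "eviction_run T \<sigma> C\<^sub>0 f C \<longleftrightarrow>
     C 1 = C\<^sub>0 \<and>
     (\<forall>t\<in>{1..T}.
        if \<sigma> t \<in> C t then C (Suc t) = C t
        else \<exists>i\<in>C t. (\<forall>j\<in>C t. f t j \<le> f t i) \<and> C (Suc t) = insert (\<sigma> t) (C t - {i}))"

definition cost :: "nat \<Rightarrow> (nat \<Rightarrow> nat) \<Rightarrow> (nat \<Rightarrow> nat set) \<Rightarrow> nat" where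
  "cost T \<sigma> C = card {t\<in>{1..T}. \<sigma> t \<notin> C t}"

definition FitF_run :: "nat \<Rightarrow> (nat \<Rightarrow> nat) \<Rightarrow> nat set \<Rightarrow> (nat \<Rightarrow> nat set) \<Rightarrow> bool" where
  "FitF_run T \<sigma> C\<^sub>0 C \<longleftrightarrow> eviction_run T \<sigma> C\<^sub>0 (next_arrival T \<sigma>) C"

definition NAT_predictions :: "nat \<Rightarrow> nat \<Rightarrow> (nat \<Rightarrow> nat) \<Rightarrow> bool" where
  "NAT_predictions n T p \<longleftrightarrow> (\<forall>t\<in>{1..T}. p t \<in> {t<..T + n})"

definition prediction_error :: "nat \<Rightarrow> (nat \<Rightarrow> nat) \<Rightarrow> (nat \<Rightarrow> nat) \<Rightarrow> nat" where
  "prediction_error T \<sigma> p = card {t\<in>{1..T}. p t \<noteq> next_arrival T \<sigma> t (\<sigma> t)}"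

text \<open>The equation for round \<open>0\<close> is a dummy; rounds start at \<open>1\<close>.\<close>

fun remedy :: "(nat \<Rightarrow> nat) \<Rightarrow> (nat \<Rightarrow> nat) \<Rightarrow> nat \<Rightarrow> nat \<Rightarrow> nat \<Rightarrow> nat" where
  "remedy \<sigma> p Z 0 i = Z + 1"
| "remedy \<sigma> p Z (Suc 0) i = (if i = \<sigma> 1 then p 1 else Z + 1)"
| "remedy \<sigma> p Z (Suc (Suc s)) i =
     (let t = Suc (Suc s); q = remedy \<sigma> p Z (Suc s) in
      if i = \<sigma> t then p t
      else if q i \<le> t \<and> q i \<le> q (\<sigma> t) \<and> q (\<sigma> t) < Z then Z
      else q i)"

definition Sim_run ::
    "nat \<Rightarrow> (nat \<Rightarrow> nat) \<Rightarrow> nat set \<Rightarrow> (nat \<Rightarrow> nat) \<Rightarrow> nat \<Rightarrow> (nat \<Rightarrow> nat set) \<Rightarrow> bool" where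
  "Sim_run T \<sigma> C\<^sub>0 p Z C \<longleftrightarrow> eviction_run T \<sigma> C\<^sub>0 (remedy \<sigma> p Z) C"

end

theory Submission
  imports Defs
begin

text \<open>
  Rank the pages by their current remedy prediction and let \<open>d x\<close> be the number of pages of
  rank at most \<open>x\<close> in the competitor's cache minus the number of those in the cache of \<open>Sim\<close>.
  Since \<open>Sim\<close> evicts a page of maximal rank, the quantity \<open>max\<^sub>x d x\<close> is a potential: it pays
  for each round in which only \<open>Sim\<close> misses, provided that the requested page has minimal rank.
  If the requested page carries a correct prediction, the remedy step moves every other
  expired page to rank \<open>Z\<close>, so its rank is indeed minimal. The exceptions are charged at
  constant cost: a move to \<open>Z\<close> and a request that contradicts the previous prediction of the
  page each identify a wrong prediction, and a first request to a page that is cached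
  identifies a page of the initial cache. A first request to any other page is a miss for
  both algorithms and is free.
\<close>

section \<open>Counting cached pages up to a rank\<close>

definition rank_count :: "('a \<Rightarrow> nat) \<Rightarrow> 'a set \<Rightarrow> nat \<Rightarrow> int" where
  "rank_count r S x = int (card {i\<in>S. r i \<le> x})"

lemma rank_count_le_card: "finite S \<Longrightarrow> rank_count r S x \<le> int (card S)"
  by (simp add: rank_count_def card_mono)

lemma rank_count_eq_card: "(\<And>i. i \<in> S \<Longrightarrow> r i \<le> x) \<Longrightarrow> rank_count r S x = int (card S)"
  unfolding rank_count_def by (metis (mono_tags, lifting) Collect_cong Collect_mem_eq)

lemma rank_count_insert:
  assumes "finite S" "j \<notin> S"
  shows "rank_count r (insert j S) x = rank_count r S x + of_bool (r j \<le> x)"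
proof -
  have "{i \<in> insert j S. r i \<le> x} =
      (if r j \<le> x then insert j {i\<in>S. r i \<le> x} else {i\<in>S. r i \<le> x})"
    by auto
  then show ?thesis
    using assms by (auto simp: rank_count_def)
qed

lemma rank_count_remove:
  assumes "finite S" "j \<in> S"
  shows "rank_count r (S - {j}) x = rank_count r S x - of_bool (r j \<le> x)"
  using rank_count_insert[of "S - {j}" j r x] assms by (simp add: insert_absorb)

lemma rank_count_split:
  assumes "finite S"
  shows "rank_count r S x = rank_count r (S - {j}) x + of_bool (j \<in> S \<and> r j \<le> x)"
  using rank_count_remove[of S j r x] assms by (cases "j \<in> S") auto

lemma rank_count_antimono:
  assumes "finite S" "\<And>i. i \<in> S \<Longrightarrow> q i \<le> r i"
  shows "rank_count r S x \<le> rank_count q S x"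
  unfolding rank_count_def using assms by (force intro!: card_mono)

text \<open>A page counted under \<open>q\<close> but not under \<open>r\<close> must have changed
  its rank. This bounds what a remedy step can take from the count of \<open>Sim\<close>.\<close>

lemma rank_count_change:
  assumes "finite S"
  shows "rank_count q S x \<le> rank_count r S x + int (card {i\<in>S. r i \<noteq> q i})"
proof -
  have "card {i\<in>S. q i \<le> x} \<le> card ({i\<in>S. r i \<le> x} \<union> {i\<in>S. r i \<noteq> q i})"
    using assms by (auto intro!: card_mono)
  also have "\<dots> \<le> card {i\<in>S. r i \<le> x} + card {i\<in>S. r i \<noteq> q i}"
    by (rule card_Un_le)
  finally show ?thesis
    by (simp add: rank_count_def)
qed

section \<open>A single round of a lazy and of a greedy cache\<close>

definition lazy_step :: "'a \<Rightarrow> 'a set \<Rightarrow> 'a set \<Rightarrow> bool" where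
  "lazy_step j S S' \<longleftrightarrow>
     (if j \<in> S then S' = S else \<exists>i\<in>S. S' = insert j (S - {i}))"

definition greedy_step :: "('a \<Rightarrow> nat) \<Rightarrow> 'a \<Rightarrow> 'a set \<Rightarrow> 'a set \<Rightarrow> bool" where
  "greedy_step r j S S' \<longleftrightarrow>
     (if j \<in> S then S' = S
      else \<exists>i\<in>S. (\<forall>l\<in>S. r l \<le> r i) \<and> S' = insert j (S - {i}))"

lemma greedy_step_imp_lazy_step: "greedy_step r j S S' \<Longrightarrow> lazy_step j S S'"
  by (auto simp: greedy_step_def lazy_step_def split: if_splits)

lemma lazy_step_finite: "lazy_step j S S' \<Longrightarrow> finite S \<Longrightarrow> finite S'"
  by (auto simp: lazy_step_def split: if_splits)

lemma lazy_step_card: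
  assumes "lazy_step j S S'" "finite S"
  shows "card S' = card S"
proof (cases "j \<in> S")
  case False
  then obtain i where i: "i \<in> S" "S' = insert j (S - {i})"
    using assms by (auto simp: lazy_step_def)
  have "0 < card S"
    using i assms(2) card_gt_0_iff by blast
  then show ?thesis
    using i assms(2) False by simp
qed (use assms in \<open>auto simp: lazy_step_def\<close>)

lemma lazy_step_subset: "lazy_step j S S' \<Longrightarrow> S' \<subseteq> insert j S"
  by (auto simp: lazy_step_def split: if_splits)

lemma lazy_step_mem: "lazy_step j S S' \<Longrightarrow> j \<in> S'"
  by (auto simp: lazy_step_def split: if_splits)

text \<open>Apart from \<open>j\<close>, the new cache contains only old pages, and exactly
  \<open>card S - 1\<close> of them. The first fact gives the first bound, the second fact the
  other.\<close>

lemma lazy_step_count_le: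
  assumes "lazy_step j S S'" "finite S"
  shows "rank_count r S' x \<le> rank_count r (S - {j}) x + of_bool (r j \<le> x)"
    and "rank_count r S' x \<le> int (card S) - 1 + of_bool (r j \<le> x)"
proof -
  have fin: "finite S'" and j: "j \<in> S'" and sub: "S' - {j} \<subseteq> S - {j}"
    using lazy_step_finite[OF assms] lazy_step_mem[OF assms(1)] lazy_step_subset[OF assms(1)] by auto
  have S': "rank_count r S' x = rank_count r (S' - {j}) x + of_bool (r j \<le> x)"
    using rank_count_split[OF fin, of r x j] j by simp
  have "rank_count r (S' - {j}) x \<le> rank_count r (S - {j}) x"
    unfolding rank_count_def using sub assms(2) by (auto intro!: card_mono)
  then show "rank_count r S' x \<le> rank_count r (S - {j}) x + of_bool (r j \<le> x)"
    using S' by simp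
  have "0 < card S'"
    using j fin card_gt_0_iff by blast
  then have "rank_count r (S' - {j}) x \<le> int (card S) - 1"
    using rank_count_le_card[of "S' - {j}" r x] fin j lazy_step_card[OF assms] by simp
  then show "rank_count r S' x \<le> int (card S) - 1 + of_bool (r j \<le> x)"
    using S' by simp
qed

text \<open>If the evicted page has rank above \<open>x\<close>, its loss is invisible at threshold
  \<open>x\<close>. Otherwise, by maximality, all of \<open>S\<close> has rank at most
  \<open>x\<close>, so the count was full and is still full up to the rank of
  \<open>j\<close>.\<close>

lemma greedy_step_count_ge:
  assumes "greedy_step r j S S'" "finite S"
  shows "rank_count r (S - {j}) x - of_bool (j \<notin> S) + of_bool (r j \<le> x) \<le> rank_count r S' x
    \<and> (rank_count r (S - {j}) x + of_bool (r j \<le> x) \<le> rank_count r S' x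
       \<or> int (card S) - 1 + of_bool (r j \<le> x) \<le> rank_count r S' x \<and> j \<notin> S)"
proof (cases "j \<in> S")
  case True
  then show ?thesis
    using assms rank_count_split[OF assms(2), of r x j] by (auto simp: greedy_step_def)
next
  case False
  then obtain f where f: "f \<in> S" "\<forall>l\<in>S. r l \<le> r f" "S' = insert j (S - {f})"
    using assms by (auto simp: greedy_step_def)
  have S': "rank_count r S' x = rank_count r S x - of_bool (r f \<le> x) + of_bool (r j \<le> x)"
    using f False assms(2) by (simp add: rank_count_insert rank_count_remove)
  have "rank_count r S x = int (card S)" if "r f \<le> x"
    using f(2) that by (intro rank_count_eq_card) fastforce
  then show ?thesis
    using S' False by auto
qed

text \<open>Here \<open>q\<close> and \<open>r\<close> are the ranks before and after the round,
  \<open>C\<close> is the greedy cache and \<open>D\<close> its competitor. Rank changes of pages in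
  \<open>C\<close> are paid one by one. In a \<open>bad\<close> round the rank change of
  \<open>j\<close>, the eviction and the miss term each cost at most 1, which the constant 3
  covers.\<close>

lemma potential_step:
  assumes fin: "finite C" "finite D" and card: "card C = card D"
    and C': "greedy_step r j C C'" and D': "lazy_step j D D'"
    and mono: "\<And>i. i \<noteq> j \<Longrightarrow> q i \<le> r i"
    and pot: "\<And>x. rank_count q D x - rank_count q C x \<le> M"
    and M: "0 \<le> M"
    and cases: "bad \<or> (j \<notin> C \<and> j \<notin> D) \<or> (\<forall>i. i \<noteq> j \<longrightarrow> q j < r i)"
  shows "rank_count r D' x - rank_count r C' x \<le>
    M + of_bool (j \<notin> D) - of_bool (j \<notin> C) + (int (card {i\<in>C - {j}. r i \<noteq> q i}) + 3 * of_bool bad)"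
proof -
  define R where "R = int (card {i\<in>C - {j}. r i \<noteq> q i})"
  define d where "d y = rank_count r (D - {j}) y" for y
  define c where "c y = rank_count r (C - {j}) y" for y
  have R: "0 \<le> R"
    by (simp add: R_def)
  \<comment> \<open>The page \<open>j\<close> is split off because its rank may drop. On the other
    pages ranks only rise, which lowers the count of \<open>D\<close> and lowers that of
    \<open>C\<close> by at most \<open>R\<close>.\<close>
  have dc: "d y + of_bool (j \<in> D \<and> q j \<le> y) - (c y + of_bool (j \<in> C \<and> q j \<le> y)) \<le> M + R" for y
  proof -
    have "d y \<le> rank_count q (D - {j}) y"
      unfolding d_def using fin mono by (intro rank_count_antimono) auto
    moreover have "rank_count q (C - {j}) y \<le> c y + R"
      unfolding c_def R_def using fin by (intro rank_count_change) auto
    ultimately show ?thesis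
      using pot[of y] rank_count_split[OF fin(1), of q y j] rank_count_split[OF fin(2), of q y j]
      by linarith
  qed
  note D'_le = lazy_step_count_le[OF D' fin(2), of r x, folded d_def]
  note C'_ge = greedy_step_count_ge[OF C' fin(1), of x, folded c_def]
  have "rank_count r D' x - rank_count r C' x \<le>
      M + R + of_bool (j \<notin> D) - of_bool (j \<notin> C) + 3 * of_bool bad"
    using cases
  proof (elim disjE)
    assume bad
    then show ?thesis
      using D'_le C'_ge dc[of x] by (simp add: of_bool_def split: if_splits)
  next
    \<comment> \<open>The two miss terms cancel. If the eviction lowers the count of
      \<open>C\<close>, that count is full, so the difference is at most 0.\<close>
    assume "j \<notin> C \<and> j \<notin> D"
    then show ?thesis
      using D'_le C'_ge dc[of x] M R card by (auto simp: of_bool_def split: if_splits)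
  next
    assume min: "\<forall>i. i \<noteq> j \<longrightarrow> q j < r i"
    have zero: "d y = 0" "c y = 0" if "y \<le> q j" for y
    proof -
      have "{i \<in> S - {j}. r i \<le> y} = {}" for S
        using min that by fastforce
      then show "d y = 0" "c y = 0"
        by (simp_all only: d_def c_def rank_count_def card.empty of_nat_0)
    qed
    \<comment> \<open>At threshold \<open>q j\<close> only \<open>j\<close> itself can count, so the
      old bound there already pays for a miss of \<open>C\<close> alone.\<close>
    have at_j: "of_bool (j \<in> D) - of_bool (j \<in> C) \<le> M + R"
      using dc[of "q j"] zero[of "q j"] by simp
    have "d x - c x + of_bool (j \<in> D) - of_bool (j \<in> C) \<le> M + R"
      using dc[of x] zero[of x] at_j by (cases "x \<le> q j") auto
    then show ?thesis
      using D'_le C'_ge at_j R card by (auto simp: of_bool_def split: if_splits)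
  qed
  then show ?thesis
    by (simp add: R_def)
qed

section \<open>Costs, remedy predictions and arrival times round by round\<close>

lemma cost_Suc: "cost (Suc t) \<sigma> C = cost t \<sigma> C + of_bool (\<sigma> (Suc t) \<notin> C (Suc t))"
proof -
  have "{s\<in>{1..Suc t}. \<sigma> s \<notin> C s} =
      (if \<sigma> (Suc t) \<notin> C (Suc t) then insert (Suc t) {s\<in>{1..t}. \<sigma> s \<notin> C s}
       else {s\<in>{1..t}. \<sigma> s \<notin> C s})"
    by (auto simp: le_Suc_eq)
  then show ?thesis
    by (simp add: cost_def)
qed

text \<open>The dummy value \<open>Z + 1\<close> in round 0 makes round 1 an instance of the general
  rule, since \<open>Z + 1 < Z\<close> rules out a reset.\<close>

lemma remedy_Suc:
  "remedy \<sigma> p Z (Suc t) i =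
     (if i = \<sigma> (Suc t) then p (Suc t)
      else if remedy \<sigma> p Z t i \<le> Suc t \<and> remedy \<sigma> p Z t i \<le> remedy \<sigma> p Z t (\<sigma> (Suc t))
        \<and> remedy \<sigma> p Z t (\<sigma> (Suc t)) < Z then Z
      else remedy \<sigma> p Z t i)"
  by (cases t) (simp_all add: Let_def)

lemma next_arrival_le:
  assumes "s < t" "t \<le> T"
  shows "next_arrival T \<sigma> s (\<sigma> t) \<le> t"
  unfolding next_arrival_def using assms by (intro Least_le) (simp add: augmented_def)

text \<open>The virtual request in round \<open>T + i\<close> shows that the \<open>LEAST\<close> is
  attained.\<close>

lemma next_arrival_arrives:
  assumes "s \<le> T" "1 \<le> i"
  shows "s < next_arrival T \<sigma> s i" "augmented T \<sigma> (next_arrival T \<sigma> s i) = i"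
proof -
  have "s < T + i \<and> augmented T \<sigma> (T + i) = i"
    using assms by (simp add: augmented_def)
  then have "s < next_arrival T \<sigma> s i \<and> augmented T \<sigma> (next_arrival T \<sigma> s i) = i"
    unfolding next_arrival_def by (rule LeastI)
  then show "s < next_arrival T \<sigma> s i" "augmented T \<sigma> (next_arrival T \<sigma> s i) = i"
    by auto
qed

text \<open>The round whose prediction gets charged. It is meaningful only for pages requested by
  round \<open>t\<close>, as \<open>Max\<close> of the empty set is unspecified.\<close>

definition last_request :: "(nat \<Rightarrow> nat) \<Rightarrow> nat \<Rightarrow> nat \<Rightarrow> nat" where
  "last_request \<sigma> t i = Max {s\<in>{1..t}. \<sigma> s = i}"

lemma last_request:
  assumes "i \<in> \<sigma> ` {1..t}"
  shows "last_request \<sigma> t i \<in> {1..t}" "\<sigma> (last_request \<sigma> t i) = i"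
    "\<And>u. last_request \<sigma> t i < u \<Longrightarrow> u \<le> t \<Longrightarrow> \<sigma> u \<noteq> i"
proof -
  have "last_request \<sigma> t i \<in> {s\<in>{1..t}. \<sigma> s = i}"
    unfolding last_request_def using assms by (intro Max_in) auto
  then show "last_request \<sigma> t i \<in> {1..t}" "\<sigma> (last_request \<sigma> t i) = i"
    by auto
  show "\<sigma> u \<noteq> i" if "last_request \<sigma> t i < u" "u \<le> t" for u
  proof
    assume "\<sigma> u = i"
    then have "u \<le> last_request \<sigma> t i"
      unfolding last_request_def using that by (intro Max_ge) auto
    then show False
      using that by simp
  qed
qed

section \<open>Remedy ranks under valid predictions\<close>

locale paging_predictions =
  fixes n k T :: nat and \<sigma> :: "nat \<Rightarrow> nat" and C\<^sub>0 :: "nat set" and p :: "nat \<Rightarrow> nat" and Z :: nat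
  assumes paging: "paging_instance n k T \<sigma> C\<^sub>0"
    and predictions: "NAT_predictions n T p"
    and Z: "T + n < Z"
begin

abbreviation q where "q \<equiv> remedy \<sigma> p Z"

definition wrong :: "nat set" where
  "wrong = {t\<in>{1..T}. p t \<noteq> next_arrival T \<sigma> t (\<sigma> t)}"

lemma finite_wrong: "finite wrong"
  by (simp add: wrong_def)

lemma card_wrong: "card wrong = prediction_error T \<sigma> p"
  by (simp add: wrong_def prediction_error_def)

text \<open>Keeps the three kinds of ranks apart: genuine predictions below \<open>Z\<close>, resets
  at \<open>Z\<close>, pages never requested at \<open>Z + 1\<close>.\<close>

lemma prediction_less: "t \<in> {1..T} \<Longrightarrow> p t < Z"
  using predictions Z by (force simp: NAT_predictions_def)

lemma remedy_le: "t \<le> T \<Longrightarrow> q t i \<le> Z + 1"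
proof (induction t)
  case (Suc t)
  then show ?case
    using prediction_less[of "Suc t"] by (auto simp: remedy_Suc)
qed simp

lemma remedy_unrequested: "i \<notin> \<sigma> ` {1..t} \<Longrightarrow> t \<le> T \<Longrightarrow> q t i = Z + 1"
proof (induction t)
  case (Suc t)
  then have "i \<notin> \<sigma> ` {1..t}" "i \<noteq> \<sigma> (Suc t)"
    by (auto simp: image_iff)
  then show ?case
    using Suc Z by (auto simp: remedy_Suc)
qed simp

text \<open>Between requests the rank changes only by a reset, and that needs an expired rank. Hence
  a rank other than \<open>Z\<close> reveals the last prediction for the page.\<close>

lemma remedy_requested:
  assumes "1 \<le> s" "s \<le> t" "t \<le> T" "\<And>u. s < u \<Longrightarrow> u \<le> t \<Longrightarrow> \<sigma> u \<noteq> \<sigma> s"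
  shows "q t (\<sigma> s) = p s \<or> (q t (\<sigma> s) = Z \<and> p s \<le> t)"
  using assms(2-4)
proof (induction t rule: dec_induct)
  case base
  obtain s' where "s = Suc s'"
    using assms(1) by (cases s) auto
  then show ?case
    by (simp add: remedy_Suc)
next
  case (step t)
  then have "q t (\<sigma> s) = p s \<or> (q t (\<sigma> s) = Z \<and> p s \<le> t)"
    by simp
  moreover have "\<sigma> s \<noteq> \<sigma> (Suc t)"
    using step.prems(2)[of "Suc t"] step.hyps by auto
  ultimately show ?case
    by (auto simp: remedy_Suc)
qed

lemma remedy_stays_reset:
  assumes "s \<le> t" "t \<le> T" "q s i = Z" "\<And>u. s < u \<Longrightarrow> u \<le> t \<Longrightarrow> \<sigma> u \<noteq> i"
  shows "q t i = Z"
  using assms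
proof (induction t rule: dec_induct)
  case (step t)
  then have "q t i = Z"
    by simp
  moreover have "i \<noteq> \<sigma> (Suc t)"
    using step.prems(3)[of "Suc t"] step.hyps by auto
  ultimately show ?case
    by (simp add: remedy_Suc)
qed simp

lemma remedy_changed:
  assumes "q (Suc t) i \<noteq> q t i" "i \<noteq> \<sigma> (Suc t)"
  shows "q t i \<le> Suc t" "q (Suc t) i = Z"
  using assms by (auto simp: remedy_Suc split: if_splits)

lemma remedy_increases:
  assumes "t < T" "i \<noteq> \<sigma> (Suc t)"
  shows "q t i \<le> q (Suc t) i"
  using assms Z by (auto simp: remedy_Suc)

text \<open>With the requested page at rank \<open>Suc t\<close>, below \<open>Z\<close>, the reset
  condition reduces to rank at most \<open>Suc t\<close>. Every other page is thus reset to
  \<open>Z\<close> or already larger.\<close>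

lemma remedy_greater_requested:
  assumes "t < T" "i \<noteq> \<sigma> (Suc t)" "q t (\<sigma> (Suc t)) = Suc t"
  shows "Suc t < q (Suc t) i"
  using assms Z by (auto simp: remedy_Suc)

section \<open>Charging resets and unpredicted requests to wrong predictions\<close>

lemma reset_wrong:
  assumes t: "t < T" and reset: "q (Suc t) i \<noteq> q t i" "i \<noteq> \<sigma> (Suc t)"
  shows "i \<in> \<sigma> ` {1..t}" "last_request \<sigma> t i \<in> wrong"
proof -
  note less = remedy_changed(1)[OF reset]
  show req: "i \<in> \<sigma> ` {1..t}"
    using remedy_unrequested[of i t] less t Z by force
  define s where "s = last_request \<sigma> t i"
  have s: "1 \<le> s" "s \<le> t" "\<sigma> s = i" "\<And>u. s < u \<Longrightarrow> u \<le> t \<Longrightarrow> \<sigma> u \<noteq> i"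
    using last_request[OF req] by (auto simp: s_def)
  \<comment> \<open>The alternative \<open>Z\<close> is excluded because the rank is at most
    \<open>Suc t\<close>, hence below \<open>Z\<close>.\<close>
  have "q t i = p s"
    using remedy_requested[of s t] s t less Z by auto
  then have ps: "p s \<le> Suc t"
    using less by simp
  \<comment> \<open>A correct \<open>p s\<close> would be a request to \<open>i\<close> after
    \<open>s\<close> and by round \<open>Suc t\<close>. There is none up to \<open>t\<close>, and
    round \<open>Suc t\<close> asks for another page.\<close>
  have "p s \<noteq> next_arrival T \<sigma> s i"
  proof
    assume eq: "p s = next_arrival T \<sigma> s i"
    have "1 \<le> i"
      using paging s t by (force simp: paging_instance_def)
    then have "s < p s" "augmented T \<sigma> (p s) = i"
      using next_arrival_arrives[of s T i \<sigma>] s t eq by auto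
    then have "\<sigma> (p s) = i"
      using ps t by (simp add: augmented_def split: if_splits)
    then show False
      using s(4)[of "p s"] \<open>s < p s\<close> ps reset(2) by (cases "p s = Suc t") auto
  qed
  then show "last_request \<sigma> t i \<in> wrong"
    using s t by (simp add: wrong_def flip: s_def)
qed

text \<open>A correct prediction at the last request would equal \<open>Suc t\<close>. It could not
  have expired by round \<open>t\<close>, so it would still be the rank of the page.\<close>

lemma request_wrong:
  assumes t: "t < T" and req: "\<sigma> (Suc t) \<in> \<sigma> ` {1..t}" and ne: "q t (\<sigma> (Suc t)) \<noteq> Suc t"
  shows "last_request \<sigma> t (\<sigma> (Suc t)) \<in> wrong"
proof -
  define i where "i = \<sigma> (Suc t)"
  define s where "s = last_request \<sigma> t i"
  have s: "1 \<le> s" "s \<le> t" "\<sigma> s = i" "\<And>u. s < u \<Longrightarrow> u \<le> t \<Longrightarrow> \<sigma> u \<noteq> i"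
    using last_request[OF req] by (auto simp: s_def i_def)
  have "p s \<noteq> next_arrival T \<sigma> s i"
  proof
    assume eq: "p s = next_arrival T \<sigma> s i"
    have le: "p s \<le> Suc t"
      using next_arrival_le[of s "Suc t" T \<sigma>] s t eq by (simp add: i_def)
    have "1 \<le> i"
      using paging s t by (force simp: paging_instance_def)
    then have arr: "s < p s" "augmented T \<sigma> (p s) = i"
      using next_arrival_arrives[of s T i \<sigma>] s t eq by auto
    then have "\<sigma> (p s) = i"
      using le t by (simp add: augmented_def split: if_splits)
    then have "p s = Suc t"
      using s(4)[of "p s"] arr(1) le by (cases "p s = Suc t") auto
    then show False
      using remedy_requested[of s t] s t ne by (auto simp: i_def)
  qed
  then show ?thesis
    using s t by (simp add: wrong_def flip: s_def i_def)
qed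

text \<open>Each reset is mapped to the last request of its page, a wrong round that determines the
  page. Two resets with the same last request are impossible: after the first the rank stays
  \<open>Z\<close>, beyond every round, and cannot expire again.\<close>

lemma card_resets_le:
  "card (SIGMA t:{..<T}. {i\<in>S t - {\<sigma> (Suc t)}. q (Suc t) i \<noteq> q t i}) \<le> prediction_error T \<sigma> p"
    (is "card ?R \<le> _")
proof -
  let ?f = "\<lambda>(t, i). last_request \<sigma> t i"
  have no_later_reset: False
    if t: "t < t'" "t' < T"
      and reset: "q (Suc t) i \<noteq> q t i" "i \<noteq> \<sigma> (Suc t)"
      and reset': "q (Suc t') i \<noteq> q t' i" "i \<noteq> \<sigma> (Suc t')"
      and eq: "last_request \<sigma> t i = last_request \<sigma> t' i" for t t' i
  proof -
    have "t < T"
      using t by simp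
    have "\<sigma> u \<noteq> i" if "Suc t < u" "u \<le> t'" for u
    proof (rule last_request(3)[OF reset_wrong(1)[OF t(2) reset'] _ that(2)])
      show "last_request \<sigma> t' i < u"
        using last_request(1)[OF reset_wrong(1)[OF \<open>t < T\<close> reset]] that eq by simp
    qed
    then have "q t' i = Z"
      using t remedy_changed(2)[OF reset] by (intro remedy_stays_reset[of "Suc t" t']) auto
    then show False
      using remedy_changed(1)[OF reset'] t Z by simp
  qed
  have "inj_on ?f ?R"
  proof (rule inj_onI, clarsimp)
    fix t i t' i'
    assume t: "t < T" and reset: "i \<noteq> \<sigma> (Suc t)" "q (Suc t) i \<noteq> q t i"
      and t': "t' < T" and reset': "i' \<noteq> \<sigma> (Suc t')" "q (Suc t') i' \<noteq> q t' i'"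
      and eq: "last_request \<sigma> t i = last_request \<sigma> t' i'"
    have i: "i = i'"
      using last_request(2)[OF reset_wrong(1)[OF t reset(2,1)]]
        last_request(2)[OF reset_wrong(1)[OF t' reset'(2,1)]] eq by simp
    then show "t = t' \<and> i = i'"
      using no_later_reset[of t t' i] no_later_reset[of t' t i] t t' reset reset' eq
      by (cases t t' rule: linorder_cases) auto
  qed
  moreover have "?f ` ?R \<subseteq> wrong"
    using reset_wrong(2) by auto
  ultimately show ?thesis
    using card_inj_on_le[OF _ _ finite_wrong] card_wrong by simp
qed

text \<open>A repeated request is charged to the previous request of the page, and distinct requests
  have distinct predecessors. A first request to a page in \<open>S t\<close> can only hit a page of
  \<open>C\<^sub>0\<close>, each at most once, which gives the term \<open>k\<close>.\<close>

lemma card_unpredicted_requests_le: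
  assumes S: "\<And>t. t < T \<Longrightarrow> S t \<subseteq> C\<^sub>0 \<union> \<sigma> ` {1..t}"
  shows "card {t. t < T \<and> q t (\<sigma> (Suc t)) \<noteq> Suc t \<and> \<sigma> (Suc t) \<in> S t} \<le> prediction_error T \<sigma> p + k"
    (is "card ?B \<le> _")
proof -
  let ?old = "{t\<in>?B. \<sigma> (Suc t) \<in> \<sigma> ` {1..t}}"
  let ?new = "{t\<in>?B. \<sigma> (Suc t) \<notin> \<sigma> ` {1..t}}"
  have "inj_on (\<lambda>t. last_request \<sigma> t (\<sigma> (Suc t))) ?old"
  proof (rule linorder_inj_onI')
    fix t t'
    assume t: "t \<in> ?old" "t' \<in> ?old" "t < t'"
    show "last_request \<sigma> t (\<sigma> (Suc t)) \<noteq> last_request \<sigma> t' (\<sigma> (Suc t'))"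
    proof
      assume eq: "last_request \<sigma> t (\<sigma> (Suc t)) = last_request \<sigma> t' (\<sigma> (Suc t'))"
      have req: "\<sigma> (Suc t) \<in> \<sigma> ` {1..t}" "\<sigma> (Suc t') \<in> \<sigma> ` {1..t'}"
        using t by auto
      have "\<sigma> (Suc t) = \<sigma> (Suc t')"
        using last_request(2)[OF req(1)] last_request(2)[OF req(2)] eq by simp
      then show False
        using last_request(3)[OF req(2), of "Suc t"] last_request(1)[OF req(1)] eq t(3) by simp
    qed
  qed
  moreover have "(\<lambda>t. last_request \<sigma> t (\<sigma> (Suc t))) ` ?old \<subseteq> wrong"
    using request_wrong by auto
  ultimately have old: "card ?old \<le> prediction_error T \<sigma> p"
    using card_inj_on_le[OF _ _ finite_wrong] card_wrong by simp
  have "inj_on (\<lambda>t. \<sigma> (Suc t)) ?new"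
  proof (rule linorder_inj_onI')
    fix t t'
    assume t: "t \<in> ?new" "t' \<in> ?new" "t < t'"
    then have "Suc t \<in> {1..t'}"
      by simp
    then show "\<sigma> (Suc t) \<noteq> \<sigma> (Suc t')"
      using t by (metis (mono_tags, lifting) imageI mem_Collect_eq)
  qed
  moreover have "(\<lambda>t. \<sigma> (Suc t)) ` ?new \<subseteq> C\<^sub>0"
    using S by blast
  moreover have "finite C\<^sub>0" "card C\<^sub>0 = k"
    using paging finite_subset by (auto simp: paging_instance_def)
  ultimately have new: "card ?new \<le> k"
    using card_inj_on_le[of "\<lambda>t. \<sigma> (Suc t)" ?new C\<^sub>0] by simp
  have "?B = ?old \<union> ?new"
    by auto
  then have "card ?B \<le> card ?old + card ?new"
    using card_Un_le[of ?old ?new] by (elim ssubst)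
  then show ?thesis
    using old new by simp
qed

section \<open>Cache runs and the comparison of costs\<close>

lemma eviction_run_step:
  assumes "eviction_run T \<sigma> C\<^sub>0 f C" "t < T"
  shows "greedy_step (f (Suc t)) (\<sigma> (Suc t)) (C (Suc t)) (C (Suc (Suc t)))"
  using assms by (auto simp: eviction_run_def greedy_step_def)

lemma eviction_run_cache:
  assumes "eviction_run T \<sigma> C\<^sub>0 f C" "t \<le> T"
  shows "finite (C (Suc t)) \<and> card (C (Suc t)) = k \<and> C (Suc t) \<subseteq> C\<^sub>0 \<union> \<sigma> ` {1..t}"
  using assms(2)
proof (induction t)
  case 0
  then show ?case
    using assms(1) paging finite_subset by (auto simp: eviction_run_def paging_instance_def)
next
  case (Suc t)
  have step: "lazy_step (\<sigma> (Suc t)) (C (Suc t)) (C (Suc (Suc t)))"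
    using greedy_step_imp_lazy_step[OF eviction_run_step[OF assms(1)]] Suc.prems by simp
  have "C (Suc (Suc t)) \<subseteq> C\<^sub>0 \<union> \<sigma> ` {1..Suc t}"
    using lazy_step_subset[OF step] Suc by (fastforce simp: atLeastAtMostSuc_conv)
  then show ?case
    using lazy_step_finite[OF step] lazy_step_card[OF step] Suc by simp
qed

text \<open>Resets contribute one \<open>prediction_error\<close>; bad rounds contribute three times
  \<open>prediction_error\<close> plus \<open>k\<close>.\<close>

theorem Sim_cost_le:
  assumes C: "Sim_run T \<sigma> C\<^sub>0 p Z C" and D: "eviction_run T \<sigma> C\<^sub>0 f D"
  shows "cost T \<sigma> C \<le> cost T \<sigma> D + 4 * prediction_error T \<sigma> p + 3 * k"
proof -
  note C = C[unfolded Sim_run_def]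
  define R where "R t = {i\<in>C (Suc t) - {\<sigma> (Suc t)}. q (Suc t) i \<noteq> q t i}" for t
  define bad where
    "bad t \<longleftrightarrow> q t (\<sigma> (Suc t)) \<noteq> Suc t \<and> \<sigma> (Suc t) \<in> C (Suc t) \<union> D (Suc t)" for t
  \<comment> \<open>The bound on the potential after \<open>t\<close> rounds; the summand for
    \<open>u\<close> belongs to round \<open>Suc u\<close>.\<close>
  define M where "M t = int (cost t \<sigma> D) - int (cost t \<sigma> C)
    + (\<Sum>u<t. int (card (R u)) + 3 * of_bool (bad u))" for t
  have M_nonneg: "0 \<le> M t"
    if "t \<le> T" "\<And>x. rank_count (q t) (D (Suc t)) x - rank_count (q t) (C (Suc t)) x \<le> M t" for t
  proof -
    \<comment> \<open>No rank exceeds \<open>Z + 1\<close>, so at this threshold both caches count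
      \<open>k\<close> pages and the difference is 0.\<close>
    have "rank_count (q t) (S (Suc t)) (Z + 1) = int k" if "eviction_run T \<sigma> C\<^sub>0 g S" for g S
      using eviction_run_cache[OF that \<open>t \<le> T\<close>] rank_count_eq_card remedy_le[OF \<open>t \<le> T\<close>] by metis
    then show ?thesis
      using that(2)[of "Z + 1"] C D by simp
  qed
  have potential: "rank_count (q t) (D (Suc t)) x - rank_count (q t) (C (Suc t)) x \<le> M t"
    if "t \<le> T" for t x
    using that
  proof (induction t arbitrary: x)
    case 0
    have "C 1 = D 1"
      using C D by (simp add: eviction_run_def)
    then show ?case
      by (simp add: M_def cost_def)
  next
    case (Suc t)
    then have t: "t < T" "t \<le> T"
      by auto
    let ?j = "\<sigma> (Suc t)"
    have "rank_count (q (Suc t)) (D (Suc (Suc t))) x - rank_count (q (Suc t)) (C (Suc (Suc t))) x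
        \<le> M t + of_bool (?j \<notin> D (Suc t)) - of_bool (?j \<notin> C (Suc t))
          + (int (card {i\<in>C (Suc t) - {?j}. q (Suc t) i \<noteq> q t i}) + 3 * of_bool (bad t))"
    proof (rule potential_step)
      show "finite (C (Suc t))" "finite (D (Suc t))" "card (C (Suc t)) = card (D (Suc t))"
        using eviction_run_cache[OF C t(2)] eviction_run_cache[OF D t(2)] by auto
      show "greedy_step (q (Suc t)) ?j (C (Suc t)) (C (Suc (Suc t)))"
        by (rule eviction_run_step[OF C t(1)])
      show "lazy_step ?j (D (Suc t)) (D (Suc (Suc t)))"
        by (rule greedy_step_imp_lazy_step[OF eviction_run_step[OF D t(1)]])
      show "q t i \<le> q (Suc t) i" if "i \<noteq> ?j" for i
        using remedy_increases t that by blast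
      show "rank_count (q t) (D (Suc t)) y - rank_count (q t) (C (Suc t)) y \<le> M t" for y
        using Suc.IH t by blast
      show "0 \<le> M t"
        using M_nonneg Suc.IH t by blast
      \<comment> \<open>If the round is not bad and some cache holds \<open>?j\<close>, its rank is
        \<open>Suc t\<close>, and every other page ends up above that.\<close>
      show "bad t \<or> (?j \<notin> C (Suc t) \<and> ?j \<notin> D (Suc t)) \<or> (\<forall>i. i \<noteq> ?j \<longrightarrow> q t ?j < q (Suc t) i)"
        using remedy_greater_requested[OF t(1)] by (auto simp: bad_def)
    qed
    also have "\<dots> = M (Suc t)"
      by (simp add: M_def R_def cost_Suc)
    finally show ?case .
  qed
  have "(\<Sum>u<T. card (R u)) = card (SIGMA u:{..<T}. R u)"
    using eviction_run_cache[OF C] by (subst card_SigmaI) (auto simp: R_def)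
  then have R: "(\<Sum>u<T. card (R u)) \<le> prediction_error T \<sigma> p"
    using card_resets_le[of "\<lambda>t. C (Suc t)"] by (simp add: R_def)
  have "(\<Sum>u<T. of_bool (bad u)) = card {u. u < T \<and> bad u}"
    by (simp add: sum_of_bool_eq Int_def)
  also have "\<dots> \<le> prediction_error T \<sigma> p + k"
    using card_unpredicted_requests_le[of "\<lambda>t. C (Suc t) \<union> D (Suc t)"]
      eviction_run_cache[OF C] eviction_run_cache[OF D]
    unfolding bad_def by (simp add: less_imp_le)
  finally have bad: "(\<Sum>u<T. of_bool (bad u)) \<le> prediction_error T \<sigma> p + k" .
  have "0 \<le> M T"
    using M_nonneg potential by blast
  also have "M T = int (cost T \<sigma> D) - int (cost T \<sigma> C)
      + (int (\<Sum>u<T. card (R u)) + 3 * int (\<Sum>u<T. of_bool (bad u)))"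
    by (simp add: M_def sum.distrib sum_distrib_left)
  finally show ?thesis
    using R bad by linarith
qed

end

theorem theorem2:
  "\<exists>c::real. c > 0 \<and>
     (\<forall>(n::nat) (k::nat) (T::nat) (\<sigma>::nat \<Rightarrow> nat) (C\<^sub>0::nat set) (p::nat \<Rightarrow> nat) (Z::nat)
        (C::nat \<Rightarrow> nat set) (D::nat \<Rightarrow> nat set).
        paging_instance n k T \<sigma> C\<^sub>0 \<longrightarrow>
        NAT_predictions n T p \<longrightarrow>
        T + n < Z \<longrightarrow>
        Sim_run T \<sigma> C\<^sub>0 p Z C \<longrightarrow>
        FitF_run T \<sigma> C\<^sub>0 D \<longrightarrow>
        real (cost T \<sigma> C) - real (cost T \<sigma> D)
          \<le> c * (real (prediction_error T \<sigma> p) + real k))"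
proof (intro exI[of _ 4] conjI allI impI)
  fix n k T :: nat and \<sigma> C\<^sub>0 p Z C D
  assume "paging_instance n k T \<sigma> C\<^sub>0" "NAT_predictions n T p" "T + n < Z"
    and runs: "Sim_run T \<sigma> C\<^sub>0 p Z C" "FitF_run T \<sigma> C\<^sub>0 D"
  then interpret paging_predictions n k T \<sigma> C\<^sub>0 p Z
    by unfold_locales
  have "cost T \<sigma> C \<le> cost T \<sigma> D + 4 * prediction_error T \<sigma> p + 3 * k"
    using Sim_cost_le runs by (simp add: FitF_run_def)
  then have "real (cost T \<sigma> C) \<le> real (cost T \<sigma> D + 4 * prediction_error T \<sigma> p + 3 * k)"
    by (rule of_nat_mono)
  \<comment> \<open>The term \<open>3 * k\<close> is relaxed to \<open>4 * k\<close>, so one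
    constant serves both terms.\<close>
  then show "real (cost T \<sigma> C) - real (cost T \<sigma> D) \<le> 4 * (real (prediction_error T \<sigma> p) + real k)"
    by simp
qed simp

end
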